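(* Let $\mathbb F$ be an algebraically closed field of characteristic $2$ and let $\mathcal H$ be the Heisenberg Lie algebra with basis $x,y,z$ and bracket $[x,y]=z$, $z$ central. Then $\dim_{\mathbb F}H^2_{*_2}(\mathcal H,0)=3$ and $\dim_{\mathbb F}H^2_{*_2}(\mathcal H,z^* )=2$. Moreover (writing only the nonzero values on the basis): (1) a basis of $H^2_{*_2}(\mathcal H,0)$ is given by the classes of $(\varphi_1,\omega_1),(\varphi_2,\omega_2),(0,\omega_3)$, with $\varphi_1(y,z)=z$, $\omega_1(y)=y$; $\varphi_2(x,z)=z$, $\omega_2(x)=x$; $\omega_3(z)=z$; (2) a basis of $H^2_{*_2}(\mathcal H,z^* )$ is given by the classes of $(\varphi_1,\omega_1),(\varphi_2,\omega_2)$, with $\varphi_1(x,y)=x$, $\omega_1(y)=y$; $\varphi_2(x,y)=y$, $\omega_2(x)=x$.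
   Context: For a linear form $\theta:\mathcal H\to\mathbb F$, $(\mathcal H,\theta)$ is the restricted Lie algebra $\mathcal H$ with $2$-map $(ax+by+cz)^{[2]}=(a^2\theta(x)+b^2\theta(y)+c^2\theta(z)+ab)z$. $z^*$ is the linear form with $z^*(x)=z^*(y)=0$, $z^*(z)=1$. $H^2_{*_2}(\mathcal H,\theta)$ denotes $H^2_{*_2}(L,L)$ for $L=(\mathcal H,\theta)$ with adjoint coefficients, defined as follows for a restricted Lie algebra $L$ in characteristic $2$. $C^2_{*_2}(L,L)$ is the vector space of pairs $(\varphi,\omega)$ with $\varphi:L\times L\to L$ alternating bilinear and $\omega:L\to L$ with $\omega(\lambda u)=\lambda^2\omega(u)$ and $\omega(u+v)=\omega(u)+\omega(v)+\varphi(u,v)$. (Thus, given $\varphi$, $\omega$ is determined by its values on a basis.) $Z^2_{*_2}(L,L)$ consists of those $(\varphi,\omega)$ with, for all $u,v,w\in L$, $\varphi([u,v],w)+\varphi([u,w],v)+\varphi([v,w],u)+[u,\varphi(v,w)]+[v,\varphi(u,w)]+[w,\varphi(u,v)]=0$ and $\varphi(u,v^{[2]})+[u,\omega(v)]+[\varphi(u,v),v]+\varphi([u,v],v)=0$. $B^2_{*_2}(L,L)$ consists of the pairs $(\varphi,\omega)$ with $\varphi(u,v)=\psi([u,v])+[u,\psi(v)]+[v,\psi(u)]$ and $\omega(u)=\psi(u^{[2]})+[u,\psi(u)]$ for some linear $\psi:L\to L$. $H^2_{*_2}(L,L)=Z^2_{*_2}(L,L)/B^2_{*_2}(L,L)$.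 *)

theory Defs
  imports
    "HOL-Analysis.Cartesian_Space"
    "HOL-Computational_Algebra.Polynomial"
    "HOL-Algebra.AbelCoset"
    "Jordan_Normal_Form.Missing_VectorSpace"
begin

section \<open>Vector spaces with a carrier set, and their quotients\<close>

text \<open>A field given by a type class, viewed as a record. This is the same term as the abbreviation
  of this name in the theory \<open>VS_Connect\<close> of \<open>Jordan_Normal_Form\<close>, which is not imported here
  because it brings in a second type \<open>vec\<close>.\<close>

abbreviation class_ring :: "'a :: {times,plus,one,zero} ring" where
  "class_ring \<equiv> \<lparr> carrier = UNIV, mult = (*), one = 1, zero = 0, add = (+) \<rparr>"

text \<open>The quotient of \<open>V\<close> by a subspace \<open>U\<close>: the carrier consists of the cosets \<open>U + v\<close>. As always
  for vector spaces represented by the record type of modules, the ring multiplication and its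
  unit are irrelevant.\<close>

definition quotient_space ::
  "('f, 'v) module \<Rightarrow> 'v set \<Rightarrow> ('f, 'v set) module"
  where "quotient_space V U =
    \<lparr> carrier = a_rcosets\<^bsub>V\<^esub> U, mult = undefined, one = undefined,
      zero = U, add = (<+>\<^bsub>V\<^esub>),
      smult = (\<lambda>a C. \<Union>c\<in>C. U +>\<^bsub>V\<^esub> (a \<odot>\<^bsub>V\<^esub> c)) \<rparr>"

lemma field_class_ring: "Ring.field (class_ring :: 'f::Fields.field ring)"
proof -
  have *: "cring (class_ring :: 'f ring)"
  proof (rule cringI)
    show "abelian_group (class_ring :: 'f ring)"
    proof (rule abelian_groupI)
      fix x :: 'f
      show "\<exists>y\<in>carrier class_ring. y \<oplus>\<^bsub>class_ring\<^esub> x = \<zero>\<^bsub>class_ring\<^esub>"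
        if "x \<in> carrier class_ring" by (auto intro: exI[of _ "-x"])
    qed (auto simp: algebra_simps)
    show "Group.comm_monoid (class_ring :: 'f ring)"
      by (rule comm_monoidI) (auto simp: algebra_simps)
  qed (auto simp: algebra_simps)
  then interpret cring "class_ring :: 'f ring" .
  show ?thesis
  proof (rule cring_fieldI2)
    fix a :: 'f assume "a \<noteq> \<zero>\<^bsub>class_ring\<^esub>"
    then show "\<exists>b\<in>carrier class_ring. a \<otimes>\<^bsub>class_ring\<^esub> b = \<one>\<^bsub>class_ring\<^esub>"
      by (auto intro: exI[of _ "inverse a"])
  qed auto
qed

lemma vectorspace_quotient_space:
  fixes V :: "('f, 'v) module" (structure)
  assumes "vectorspace K V" and "VectorSpace.subspace K U V"
  shows "vectorspace K (quotient_space V U)"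
proof -
  interpret vectorspace K V by fact
  have sub: "LinearCombinations.submodule K U V"
    using assms(2) by (simp add: VectorSpace.subspace_def)
  have UV: "U \<subseteq> carrier V" and U0: "\<zero> \<in> U"
    and Ua: "\<And>v w. v \<in> U \<Longrightarrow> w \<in> U \<Longrightarrow> v \<oplus> w \<in> U"
    and Us: "\<And>c v. c \<in> carrier K \<Longrightarrow> v \<in> U \<Longrightarrow> c \<odot> v \<in> U"
    using sub by (auto simp: LinearCombinations.submodule_def)
  have Un: "\<ominus> v \<in> U" if "v \<in> U" for v
    using Us[of "\<ominus>\<^bsub>K\<^esub> \<one>\<^bsub>K\<^esub>" v] that UV by (auto simp: smult_minus_1)
  have "additive_subgroup U V"
    unfolding additive_subgroup_def
    by (rule subgroup.intro) (use UV U0 Ua Un in \<open>auto simp: a_inv_def[symmetric]\<close>)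
  then interpret Q: abelian_subgroup U V
    using abelian_subgroupI3 M.abelian_group_axioms by blast
  let ?Q = "quotient_space V U"
  define sm where "sm = (\<lambda>a C. \<Union>c\<in>C. U +> (a \<odot> c))"
  have simps: "carrier ?Q = a_rcosets U" "zero ?Q = U" "add ?Q = (<+>\<^bsub>V\<^esub>)"
    "smult ?Q = sm"
    by (simp_all add: quotient_space_def sm_def)
  have cos: "\<exists>v\<in>carrier V. C = U +> v" if "C \<in> a_rcosets U" for C
    using that by (auto simp: A_RCOSETS_def')
  have inC: "U +> v \<in> a_rcosets U" if "v \<in> carrier V" for v
    using that by (auto simp: A_RCOSETS_def')
  have plus: "(U +> v) <+>\<^bsub>V\<^esub> (U +> w) = U +> (v \<oplus> w)" if "v \<in> carrier V" "w \<in> carrier V" for v w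
    using that by (rule Q.a_rcos_sum)
  have U_eq: "U +> \<zero> = U"
    using UV by (rule M.a_coset_add_zero)
  have scal: "sm a (U +> v) = U +> (a \<odot> v)"
    if "v \<in> carrier V" "a \<in> carrier K" for v a
  proof -
    have "U +> (a \<odot> c) = U +> (a \<odot> v)" if c: "c \<in> U +> v" for c
    proof -
      obtain u where u: "u \<in> U" "c = u \<oplus> v" using c by (auto simp: a_r_coset_def')
      then have "a \<odot> c = a \<odot> u \<oplus> a \<odot> v"
        using UV \<open>v \<in> carrier V\<close> \<open>a \<in> carrier K\<close> by (auto simp: smult_r_distr)
      then have "a \<odot> c \<in> U +> (a \<odot> v)"
        using u Us \<open>a \<in> carrier K\<close> by (auto simp: a_r_coset_def')
      then show ?thesis
        using Q.a_repr_independence' \<open>v \<in> carrier V\<close> \<open>a \<in> carrier K\<close>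
        by (metis smult_closed)
    qed
    moreover have "v \<in> U +> v" using that(1) by (rule Q.a_rcos_self)
    ultimately show ?thesis unfolding sm_def by blast
  qed
  have "module K ?Q"
  proof (rule module_criteria)
    show "cring K" by (rule R.cring_axioms)
    show "\<zero>\<^bsub>?Q\<^esub> \<in> carrier ?Q"
      unfolding simps using inC[of \<zero>] U_eq by simp
    show "\<forall>v w. v \<in> carrier ?Q \<and> w \<in> carrier ?Q \<longrightarrow> v \<oplus>\<^bsub>?Q\<^esub> w \<in> carrier ?Q"
      unfolding simps using cos inC plus by (metis M.add.m_closed)
    show "\<forall>v\<in>carrier ?Q. \<exists>neg_v\<in>carrier ?Q. v \<oplus>\<^bsub>?Q\<^esub> neg_v = \<zero>\<^bsub>?Q\<^esub>"
      unfolding simps using cos inC plus U_eq by (metis M.add.inv_closed M.r_neg)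
    show "\<forall>c v. c \<in> carrier K \<and> v \<in> carrier ?Q \<longrightarrow> c \<odot>\<^bsub>?Q\<^esub> v \<in> carrier ?Q"
      unfolding simps using cos inC scal by (metis smult_closed)
    show "\<forall>v w. v \<in> carrier ?Q \<and> w \<in> carrier ?Q \<longrightarrow> v \<oplus>\<^bsub>?Q\<^esub> w = w \<oplus>\<^bsub>?Q\<^esub> v"
      unfolding simps using cos plus by (metis M.a_comm)
    show "\<forall>v w x. v \<in> carrier ?Q \<and> w \<in> carrier ?Q \<and> x \<in> carrier ?Q \<longrightarrow>
        v \<oplus>\<^bsub>?Q\<^esub> w \<oplus>\<^bsub>?Q\<^esub> x = v \<oplus>\<^bsub>?Q\<^esub> (w \<oplus>\<^bsub>?Q\<^esub> x)"
      unfolding simps by (auto dest!: cos simp: plus M.a_assoc)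
    show "\<forall>v\<in>carrier ?Q. v \<oplus>\<^bsub>?Q\<^esub> \<zero>\<^bsub>?Q\<^esub> = v"
      unfolding simps using cos plus U_eq by (metis M.r_zero M.add.one_closed)
    show "\<forall>a b v. a \<in> carrier K \<and> b \<in> carrier K \<and> v \<in> carrier ?Q \<longrightarrow>
        (a \<otimes>\<^bsub>K\<^esub> b) \<odot>\<^bsub>?Q\<^esub> v = a \<odot>\<^bsub>?Q\<^esub> (b \<odot>\<^bsub>?Q\<^esub> v)"
      unfolding simps by (auto dest!: cos simp: scal smult_assoc1)
    show "\<forall>v\<in>carrier ?Q. \<one>\<^bsub>K\<^esub> \<odot>\<^bsub>?Q\<^esub> v = v"
      unfolding simps by (auto dest!: cos simp: scal)
    show "\<forall>a b v. a \<in> carrier K \<and> b \<in> carrier K \<and> v \<in> carrier ?Q \<longrightarrow>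
        (a \<oplus>\<^bsub>K\<^esub> b) \<odot>\<^bsub>?Q\<^esub> v = a \<odot>\<^bsub>?Q\<^esub> v \<oplus>\<^bsub>?Q\<^esub> b \<odot>\<^bsub>?Q\<^esub> v"
      unfolding simps by (auto dest!: cos simp: scal plus smult_l_distr)
    show "\<forall>a v w. a \<in> carrier K \<and> v \<in> carrier ?Q \<and> w \<in> carrier ?Q \<longrightarrow>
        a \<odot>\<^bsub>?Q\<^esub> (v \<oplus>\<^bsub>?Q\<^esub> w) = a \<odot>\<^bsub>?Q\<^esub> v \<oplus>\<^bsub>?Q\<^esub> a \<odot>\<^bsub>?Q\<^esub> w"
      unfolding simps by (auto dest!: cos simp: scal plus smult_r_distr)
  qed
  then show ?thesis by (simp add: vectorspace_def field_axioms)
qed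


section \<open>Restricted Lie algebras in characteristic 2 and their second cohomology\<close>

type_synonym 'l cochain2 = "('l \<Rightarrow> 'l \<Rightarrow> 'l) \<times> ('l \<Rightarrow> 'l)"

locale restricted_lie_algebra_char2 = vector_space scale
  for scale :: "'f::Fields.field \<Rightarrow> 'l::ab_group_add \<Rightarrow> 'l" (infixr \<open>\<cdot>\<close> 75) +
  fixes bracket :: "'l \<Rightarrow> 'l \<Rightarrow> 'l" (\<open>\<lbrakk>_,/ _\<rbrakk>\<close>)
    and sq :: "'l \<Rightarrow> 'l"  \<comment> \<open>the 2-map\<close>
  assumes char_2: "CHAR('f) = 2"
    and bracket_linear_right: "Vector_Spaces.linear (\<cdot>) (\<cdot>) (\<lambda>v. \<lbrakk>u, v\<rbrakk>)"
    and bracket_linear_left: "Vector_Spaces.linear (\<cdot>) (\<cdot>) (\<lambda>u. \<lbrakk>u, v\<rbrakk>)"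
    and bracket_alternating: "\<lbrakk>u, u\<rbrakk> = 0"
    and jacobi: "\<lbrakk>u, \<lbrakk>v, w\<rbrakk>\<rbrakk> + \<lbrakk>v, \<lbrakk>w, u\<rbrakk>\<rbrakk> + \<lbrakk>w, \<lbrakk>u, v\<rbrakk>\<rbrakk> = 0"
    and sq_scale: "sq (a \<cdot> u) = a^2 \<cdot> sq u"
    and sq_add: "sq (u + v) = sq u + sq v + \<lbrakk>u, v\<rbrakk>"
    and bracket_sq: "\<lbrakk>u, sq v\<rbrakk> = \<lbrakk>\<lbrakk>u, v\<rbrakk>, v\<rbrakk>"
begin

definition C2 :: "('f, 'l cochain2) module"
  where "C2 =
    \<lparr> carrier = {(\<phi>, \<omega>).
        (\<forall>u. Vector_Spaces.linear (\<cdot>) (\<cdot>) (\<lambda>v. \<phi> u v)) \<and>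
        (\<forall>v. Vector_Spaces.linear (\<cdot>) (\<cdot>) (\<lambda>u. \<phi> u v)) \<and>
        (\<forall>u. \<phi> u u = 0) \<and>
        (\<forall>a u. \<omega> (a \<cdot> u) = a^2 \<cdot> \<omega> u) \<and>
        (\<forall>u v. \<omega> (u + v) = \<omega> u + \<omega> v + \<phi> u v)},
      mult = undefined, one = undefined,
      zero = (\<lambda>u v. 0, \<lambda>u. 0),
      add = (\<lambda>(\<phi>, \<omega>) (\<phi>', \<omega>'). (\<lambda>u v. \<phi> u v + \<phi>' u v, \<lambda>u. \<omega> u + \<omega>' u)),
      smult = (\<lambda>a (\<phi>, \<omega>). (\<lambda>u v. a \<cdot> \<phi> u v, \<lambda>u. a \<cdot> \<omega> u)) \<rparr>"

definition Z2 :: "'l cochain2 set"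
  where "Z2 = {(\<phi>, \<omega>) \<in> carrier C2.
    (\<forall>u v w. \<phi> \<lbrakk>u, v\<rbrakk> w + \<phi> \<lbrakk>u, w\<rbrakk> v + \<phi> \<lbrakk>v, w\<rbrakk> u
           + \<lbrakk>u, \<phi> v w\<rbrakk> + \<lbrakk>v, \<phi> u w\<rbrakk> + \<lbrakk>w, \<phi> u v\<rbrakk> = 0) \<and>
    (\<forall>u v. \<phi> u (sq v) + \<lbrakk>u, \<omega> v\<rbrakk> + \<lbrakk>\<phi> u v, v\<rbrakk> + \<phi> \<lbrakk>u, v\<rbrakk> v = 0)}"

definition B2 :: "'l cochain2 set"
  where "B2 = {(\<phi>, \<omega>). \<exists>\<psi>. Vector_Spaces.linear (\<cdot>) (\<cdot>) \<psi> \<and>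
    (\<forall>u v. \<phi> u v = \<psi> \<lbrakk>u, v\<rbrakk> + \<lbrakk>u, \<psi> v\<rbrakk> + \<lbrakk>v, \<psi> u\<rbrakk>) \<and>
    (\<forall>u. \<omega> u = \<psi> (sq u) + \<lbrakk>u, \<psi> u\<rbrakk>)}"

definition H2 :: "('f, 'l cochain2 set) module"
  where "H2 = quotient_space (C2\<lparr>carrier := Z2\<rparr>) B2"

definition coh_class :: "'l cochain2 \<Rightarrow> 'l cochain2 set"
  where "coh_class c = B2 +>\<^bsub>C2\<lparr>carrier := Z2\<rparr>\<^esub> c"

lemma double_0 [simp]: "(u::'l) + u = 0"
proof -
  have "(1::'f) + 1 = 0"
    using of_nat_CHAR[where 'a='f] by (simp add: char_2)
  then have "(1 + 1) \<cdot> u = 0" by simp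
  then show ?thesis by (simp only: scale_left_distrib scale_one)
qed

lemma double_0' [simp]: "(u::'l) + (u + v) = v"
  by (metis add.assoc add_0 double_0)

lemma uminus_eq [simp]: "- (u::'l) = u"
  by (metis double_0 eq_neg_iff_add_eq_0)

lemma bracket_simps:
  "\<lbrakk>u, v + w\<rbrakk> = \<lbrakk>u, v\<rbrakk> + \<lbrakk>u, w\<rbrakk>" "\<lbrakk>u + v, w\<rbrakk> = \<lbrakk>u, w\<rbrakk> + \<lbrakk>v, w\<rbrakk>"
  "\<lbrakk>u, a \<cdot> v\<rbrakk> = a \<cdot> \<lbrakk>u, v\<rbrakk>" "\<lbrakk>a \<cdot> u, v\<rbrakk> = a \<cdot> \<lbrakk>u, v\<rbrakk>"
  "\<lbrakk>u, 0\<rbrakk> = 0" "\<lbrakk>0, u\<rbrakk> = 0"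
  using bracket_linear_right[of u] bracket_linear_left[of v] bracket_linear_left[of w]
    bracket_linear_left[of u]
  by (simp_all add: Vector_Spaces.linear_iff)
     (metis add_cancel_right_right add_0)+

lemma bracket_commute: "\<lbrakk>u, v\<rbrakk> = \<lbrakk>v, u\<rbrakk>"
proof -
  have "\<lbrakk>u + v, u + v\<rbrakk> = 0" by (rule bracket_alternating)
  then have "\<lbrakk>u, v\<rbrakk> + \<lbrakk>v, u\<rbrakk> = 0"
    unfolding bracket_simps by (simp add: bracket_alternating add_ac)
  then show ?thesis by (metis eq_neg_iff_add_eq_0 uminus_eq)
qed

lemma bracket_bracket: "\<lbrakk>\<lbrakk>u, v\<rbrakk>, w\<rbrakk> = \<lbrakk>u, \<lbrakk>v, w\<rbrakk>\<rbrakk> + \<lbrakk>v, \<lbrakk>u, w\<rbrakk>\<rbrakk>"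
  using jacobi[of u v w]
  by (metis bracket_commute add.commute eq_neg_iff_add_eq_0 uminus_eq)

lemma linear_add_simps:
  assumes "Vector_Spaces.linear (\<cdot>) (\<cdot>) \<psi>"
  shows "\<psi> (u + v) = \<psi> u + \<psi> v" "\<psi> (a \<cdot> u) = a \<cdot> \<psi> u"
  using assms by (simp_all add: Vector_Spaces.linear_iff)

lemma mem_C2:
  "(\<phi>, \<omega>) \<in> carrier C2 \<longleftrightarrow>
    (\<forall>u v w. \<phi> u (v + w) = \<phi> u v + \<phi> u w) \<and> (\<forall>u v a. \<phi> u (a \<cdot> v) = a \<cdot> \<phi> u v) \<and>
    (\<forall>u v w. \<phi> (u + v) w = \<phi> u w + \<phi> v w) \<and> (\<forall>u v a. \<phi> (a \<cdot> u) v = a \<cdot> \<phi> u v) \<and>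
    (\<forall>u. \<phi> u u = 0) \<and> (\<forall>a u. \<omega> (a \<cdot> u) = a^2 \<cdot> \<omega> u) \<and>
    (\<forall>u v. \<omega> (u + v) = \<omega> u + \<omega> v + \<phi> u v)"
  using vector_space_axioms by (auto simp: C2_def Vector_Spaces.linear_iff)

lemma C2_simps:
  "\<zero>\<^bsub>C2\<^esub> = (\<lambda>u v. 0, \<lambda>u. 0)"
  "(\<phi>, \<omega>) \<oplus>\<^bsub>C2\<^esub> (\<phi>', \<omega>') = (\<lambda>u v. \<phi> u v + \<phi>' u v, \<lambda>u. \<omega> u + \<omega>' u)"
  "a \<odot>\<^bsub>C2\<^esub> (\<phi>, \<omega>) = (\<lambda>u v. a \<cdot> \<phi> u v, \<lambda>u. a \<cdot> \<omega> u)"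
  by (simp_all add: C2_def)

lemma vectorspace_C2: "vectorspace class_ring C2"
proof -
  interpret K: Ring.field "class_ring :: 'f ring" by (rule field_class_ring)
  have "Module.module (class_ring :: 'f ring) C2"
  proof (rule module_criteria)
    show "cring (class_ring :: 'f ring)" by (rule K.cring_axioms)
    show "\<forall>v\<in>carrier C2. \<exists>neg_v\<in>carrier C2. v \<oplus>\<^bsub>C2\<^esub> neg_v = \<zero>\<^bsub>C2\<^esub>"
    proof
      fix v assume "v \<in> carrier C2"
      then show "\<exists>neg_v\<in>carrier C2. v \<oplus>\<^bsub>C2\<^esub> neg_v = \<zero>\<^bsub>C2\<^esub>"
        by (intro bexI[of _ v]) (cases v, auto simp: C2_simps)
    qed
  qed (auto simp: mem_C2 C2_simps algebra_simps)
  then show ?thesis by (simp add: vectorspace_def field_class_ring)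
qed

lemma subspace_Z2: "VectorSpace.subspace class_ring Z2 C2"
proof -
  have "LinearCombinations.submodule class_ring Z2 C2"
  proof (rule LinearCombinations.submodule.intro)
    show "Module.module class_ring C2"
      using vectorspace_C2 by (simp add: vectorspace_def)
    show "v \<oplus>\<^bsub>C2\<^esub> w \<in> Z2" if vw: "v \<in> Z2" "w \<in> Z2" for v w
    proof -
      obtain \<phi> \<omega> \<phi>' \<omega>' where [simp]: "v = (\<phi>, \<omega>)" "w = (\<phi>', \<omega>')" by (metis surj_pair)
      have "v \<oplus>\<^bsub>C2\<^esub> w \<in> carrier C2"
        using vw by (auto simp: Z2_def mem_C2 C2_simps algebra_simps)
      moreover have "\<phi> \<lbrakk>x, y\<rbrakk> z + \<phi>' \<lbrakk>x, y\<rbrakk> z + (\<phi> \<lbrakk>x, z\<rbrakk> y + \<phi>' \<lbrakk>x, z\<rbrakk> y)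
          + (\<phi> \<lbrakk>y, z\<rbrakk> x + \<phi>' \<lbrakk>y, z\<rbrakk> x) + \<lbrakk>x, \<phi> y z + \<phi>' y z\<rbrakk> + \<lbrakk>y, \<phi> x z + \<phi>' x z\<rbrakk>
          + \<lbrakk>z, \<phi> x y + \<phi>' x y\<rbrakk> = 0" for x y z
      proof -
        have "(\<phi> \<lbrakk>x, y\<rbrakk> z + \<phi> \<lbrakk>x, z\<rbrakk> y + \<phi> \<lbrakk>y, z\<rbrakk> x
           + \<lbrakk>x, \<phi> y z\<rbrakk> + \<lbrakk>y, \<phi> x z\<rbrakk> + \<lbrakk>z, \<phi> x y\<rbrakk>)
          + (\<phi>' \<lbrakk>x, y\<rbrakk> z + \<phi>' \<lbrakk>x, z\<rbrakk> y + \<phi>' \<lbrakk>y, z\<rbrakk> x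
           + \<lbrakk>x, \<phi>' y z\<rbrakk> + \<lbrakk>y, \<phi>' x z\<rbrakk> + \<lbrakk>z, \<phi>' x y\<rbrakk>) = 0"
          using vw by (simp add: Z2_def)
        then show ?thesis by (simp add: bracket_simps add_ac)
      qed
      moreover have "\<phi> x (sq y) + \<phi>' x (sq y) + \<lbrakk>x, \<omega> y + \<omega>' y\<rbrakk>
          + \<lbrakk>\<phi> x y + \<phi>' x y, y\<rbrakk> + (\<phi> \<lbrakk>x, y\<rbrakk> y + \<phi>' \<lbrakk>x, y\<rbrakk> y) = 0" for x y
      proof -
        have "(\<phi> x (sq y) + \<lbrakk>x, \<omega> y\<rbrakk> + \<lbrakk>\<phi> x y, y\<rbrakk> + \<phi> \<lbrakk>x, y\<rbrakk> y)
          + (\<phi>' x (sq y) + \<lbrakk>x, \<omega>' y\<rbrakk> + \<lbrakk>\<phi>' x y, y\<rbrakk> + \<phi>' \<lbrakk>x, y\<rbrakk> y) = 0"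
          using vw by (simp add: Z2_def)
        then show ?thesis by (simp add: bracket_simps add_ac)
      qed
      ultimately show ?thesis by (simp add: Z2_def C2_simps)
    qed
    show "c \<odot>\<^bsub>C2\<^esub> v \<in> Z2" if v: "v \<in> Z2" for c v
    proof -
      obtain \<phi> \<omega> where [simp]: "v = (\<phi>, \<omega>)" by (metis surj_pair)
      have "c \<odot>\<^bsub>C2\<^esub> v \<in> carrier C2"
        using v by (auto simp: Z2_def mem_C2 C2_simps algebra_simps)
      then show ?thesis
        using v by (auto simp: Z2_def C2_simps bracket_simps scale_right_distrib[symmetric]
            simp del: scale_right_distrib)
    qed
    show "\<zero>\<^bsub>C2\<^esub> \<in> Z2" by (simp add: Z2_def mem_C2 C2_simps bracket_simps)
  qed (auto simp: Z2_def)
  then show ?thesis by (simp add: VectorSpace.subspace_def vectorspace_C2)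
qed

lemma B2_subset_Z2: "B2 \<subseteq> Z2"
proof
  fix c assume "c \<in> B2"
  then obtain \<phi> \<omega> \<psi> where c [simp]: "c = (\<phi>, \<omega>)"
    and lin: "Vector_Spaces.linear (\<cdot>) (\<cdot>) \<psi>"
    and \<phi>: "\<And>u v. \<phi> u v = \<psi> \<lbrakk>u, v\<rbrakk> + \<lbrakk>u, \<psi> v\<rbrakk> + \<lbrakk>v, \<psi> u\<rbrakk>"
    and \<omega>: "\<And>u. \<omega> u = \<psi> (sq u) + \<lbrakk>u, \<psi> u\<rbrakk>"
    by (auto simp: B2_def)
  note lin = linear_add_simps[OF lin]
  have \<psi>0: "\<psi> 0 = 0" using lin(2)[of 0 0] by simp
  have "c \<in> carrier C2"
    by (auto simp: mem_C2 \<phi> \<omega> lin \<psi>0 bracket_simps bracket_alternating sq_add sq_scale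
        algebra_simps power2_eq_square)
  moreover have "\<phi> \<lbrakk>u, v\<rbrakk> w + \<phi> \<lbrakk>u, w\<rbrakk> v + \<phi> \<lbrakk>v, w\<rbrakk> u
      + \<lbrakk>u, \<phi> v w\<rbrakk> + \<lbrakk>v, \<phi> u w\<rbrakk> + \<lbrakk>w, \<phi> u v\<rbrakk> = 0" for u v w
    by (simp add: \<phi> lin bracket_simps bracket_bracket bracket_commute[of w v]
        bracket_commute[of w u] bracket_commute[of v u] add_ac)
  moreover have "\<phi> u (sq v) + \<lbrakk>u, \<omega> v\<rbrakk> + \<lbrakk>\<phi> u v, v\<rbrakk> + \<phi> \<lbrakk>u, v\<rbrakk> v = 0" for u v
    by (simp add: \<phi> \<omega> lin bracket_simps bracket_sq bracket_commute[of "sq v" "\<psi> u"]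
        bracket_commute[of _ v] bracket_bracket bracket_alternating \<psi>0 add_ac)
  ultimately show "c \<in> Z2" by (auto simp: Z2_def)
qed

lemma subspace_B2: "VectorSpace.subspace class_ring B2 (C2\<lparr>carrier := Z2\<rparr>)"
proof -
  interpret C: vectorspace class_ring C2 by (rule vectorspace_C2)
  have vs: "vectorspace class_ring (C2\<lparr>carrier := Z2\<rparr>)"
    using C.subspace_is_vs[OF subspace_Z2] .
  have "LinearCombinations.submodule class_ring B2 (C2\<lparr>carrier := Z2\<rparr>)"
  proof (rule LinearCombinations.submodule.intro)
    show "Module.module class_ring (C2\<lparr>carrier := Z2\<rparr>)"
      using vs by (simp add: vectorspace_def)
    show "B2 \<subseteq> carrier (C2\<lparr>carrier := Z2\<rparr>)" using B2_subset_Z2 by simp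
    show "v \<oplus>\<^bsub>C2\<lparr>carrier := Z2\<rparr>\<^esub> w \<in> B2" if vw: "v \<in> B2" "w \<in> B2" for v w
    proof -
      obtain \<phi> \<omega> \<psi> where 1: "v = (\<phi>, \<omega>)" "Vector_Spaces.linear (\<cdot>) (\<cdot>) \<psi>"
        "\<And>u v. \<phi> u v = \<psi> \<lbrakk>u, v\<rbrakk> + \<lbrakk>u, \<psi> v\<rbrakk> + \<lbrakk>v, \<psi> u\<rbrakk>" "\<And>u. \<omega> u = \<psi> (sq u) + \<lbrakk>u, \<psi> u\<rbrakk>"
        using vw(1) by (auto simp: B2_def)
      obtain \<phi>' \<omega>' \<psi>' where 2: "w = (\<phi>', \<omega>')" "Vector_Spaces.linear (\<cdot>) (\<cdot>) \<psi>'"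
        "\<And>u v. \<phi>' u v = \<psi>' \<lbrakk>u, v\<rbrakk> + \<lbrakk>u, \<psi>' v\<rbrakk> + \<lbrakk>v, \<psi>' u\<rbrakk>"
        "\<And>u. \<omega>' u = \<psi>' (sq u) + \<lbrakk>u, \<psi>' u\<rbrakk>"
        using vw(2) by (auto simp: B2_def)
      have "Vector_Spaces.linear (\<cdot>) (\<cdot>) (\<lambda>u. \<psi> u + \<psi>' u)"
        using 1(2) 2(2) by (auto simp: Vector_Spaces.linear_iff algebra_simps)
      then show ?thesis
        by (auto simp: B2_def 1 2 C2_simps bracket_simps add_ac intro!: exI[of _ "\<lambda>u. \<psi> u + \<psi>' u"])
    qed
    show "a \<odot>\<^bsub>C2\<lparr>carrier := Z2\<rparr>\<^esub> v \<in> B2" if v: "v \<in> B2" for a v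
    proof -
      obtain \<phi> \<omega> \<psi> where 1: "v = (\<phi>, \<omega>)" "Vector_Spaces.linear (\<cdot>) (\<cdot>) \<psi>"
        "\<And>u v. \<phi> u v = \<psi> \<lbrakk>u, v\<rbrakk> + \<lbrakk>u, \<psi> v\<rbrakk> + \<lbrakk>v, \<psi> u\<rbrakk>" "\<And>u. \<omega> u = \<psi> (sq u) + \<lbrakk>u, \<psi> u\<rbrakk>"
        using v by (auto simp: B2_def)
      have "Vector_Spaces.linear (\<cdot>) (\<cdot>) (\<lambda>u. a \<cdot> \<psi> u)"
        using 1(2) by (auto simp: Vector_Spaces.linear_iff algebra_simps)
      then show ?thesis
        by (auto simp: B2_def 1 C2_simps bracket_simps algebra_simps intro!: exI[of _ "\<lambda>u. a \<cdot> \<psi> u"])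
    qed
    have "Vector_Spaces.linear (\<cdot>) (\<cdot>) (\<lambda>u. 0 :: 'l)"
      using vector_space_axioms by (auto simp: Vector_Spaces.linear_iff)
    then show "\<zero>\<^bsub>C2\<lparr>carrier := Z2\<rparr>\<^esub> \<in> B2"
      by (auto simp: B2_def C2_simps bracket_simps intro!: exI[of _ "\<lambda>u. 0"])
  qed
  then show ?thesis by (simp add: VectorSpace.subspace_def vs)
qed

theorem vectorspace_H2: "vectorspace class_ring H2"
  unfolding H2_def using subspace_B2
  by (intro vectorspace_quotient_space) (auto simp: VectorSpace.subspace_def)

end


section \<open>The Heisenberg algebra\<close>

abbreviation hx :: "'f::Fields.field ^ 3" where "hx \<equiv> axis 1 1"
abbreviation hy :: "'f::Fields.field ^ 3" where "hy \<equiv> axis 2 1"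
abbreviation hz :: "'f::Fields.field ^ 3" where "hz \<equiv> axis 3 1"

definition heis_bracket :: "'f::Fields.field ^ 3 \<Rightarrow> 'f ^ 3 \<Rightarrow> 'f ^ 3"
  where "heis_bracket u v = (u $ 1 * v $ 2 - u $ 2 * v $ 1) *s hz"

definition heis_sq :: "('f::Fields.field ^ 3 \<Rightarrow> 'f) \<Rightarrow> 'f ^ 3 \<Rightarrow> 'f ^ 3"
  where "heis_sq \<theta> v =
    ((v $ 1)^2 * \<theta> hx + (v $ 2)^2 * \<theta> hy + (v $ 3)^2 * \<theta> hz + v $ 1 * v $ 2) *s hz"

abbreviation zstar :: "'f::Fields.field ^ 3 \<Rightarrow> 'f" where "zstar v \<equiv> v $ 3"

abbreviation heis_H2 where
  "heis_H2 \<theta> \<equiv> restricted_lie_algebra_char2.H2 (*s) heis_bracket (heis_sq \<theta>)"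

abbreviation heis_class where
  "heis_class \<theta> \<equiv> restricted_lie_algebra_char2.coh_class (*s) heis_bracket (heis_sq \<theta>)"

text \<open>The element \<open>(\<phi>, \<omega>)\<close> of \<open>C2\<close> with \<open>\<phi>(x,y) = p\<close>, \<open>\<phi>(x,z) = q\<close>, \<open>\<phi>(y,z) = r\<close>,
  \<open>\<omega>(x) = s\<close>, \<open>\<omega>(y) = t\<close>, \<open>\<omega>(z) = w\<close>; lemma \<open>heis_cochain_unique\<close> below shows that there is
  exactly one.\<close>

definition heis_cochain ::
  "'f::Fields.field ^ 3 \<Rightarrow> 'f ^ 3 \<Rightarrow> 'f ^ 3 \<Rightarrow> 'f ^ 3 \<Rightarrow> 'f ^ 3 \<Rightarrow> 'f ^ 3 \<Rightarrow> ('f ^ 3) cochain2"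
  where "heis_cochain p q r s t w =
    (\<lambda>u v. (u $ 1 * v $ 2 - u $ 2 * v $ 1) *s p + (u $ 1 * v $ 3 - u $ 3 * v $ 1) *s q
         + (u $ 2 * v $ 3 - u $ 3 * v $ 2) *s r,
     \<lambda>u. (u $ 1)^2 *s s + (u $ 2)^2 *s t + (u $ 3)^2 *s w
         + (u $ 1 * u $ 2) *s p + (u $ 1 * u $ 3) *s q + (u $ 2 * u $ 3) *s r)"

lemma char_2_minus: "CHAR('f::Fields.field) = 2 \<Longrightarrow> (a::'f) - b = a + b"
  by (rule minus_CHAR_2)

lemma char_2_double: "CHAR('f::Fields.field) = 2 \<Longrightarrow> (a::'f) + a = 0"
  using minus_CHAR_2[of a a] by simp

lemma char_2_double': "CHAR('f::Fields.field) = 2 \<Longrightarrow> (a::'f) + (a + b) = b"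
  by (metis add.assoc add_0 char_2_double)

lemma restricted_lie_algebra_heisenberg:
  fixes \<theta> :: "'f::Fields.field ^ 3 \<Rightarrow> 'f"
  assumes char: "CHAR('f) = 2" and "Vector_Spaces.linear (*s) (*) \<theta>"
  shows "restricted_lie_algebra_char2 (*s) heis_bracket (heis_sq \<theta>)"
proof unfold_locales
  show "CHAR('f) = 2" by (rule char)
qed (auto simp: heis_bracket_def heis_sq_def vec_eq_iff axis_def algebra_simps power2_eq_square
    char_2_minus[OF char] char_2_double[OF char] char_2_double'[OF char])

lemma heis_expand: "(u::'f::Fields.field ^ 3) = u $ 1 *s hx + (u $ 2 *s hy + u $ 3 *s hz)"
  by (simp add: vec_eq_iff forall_3 axis_def)

lemma heis_cochain_unique:
  fixes \<theta> :: "'f::Fields.field ^ 3 \<Rightarrow> 'f"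
    and \<phi> :: "'f ^ 3 \<Rightarrow> 'f ^ 3 \<Rightarrow> 'f ^ 3" and \<omega> :: "'f ^ 3 \<Rightarrow> 'f ^ 3"
  assumes char: "CHAR('f) = 2" and \<theta>: "Vector_Spaces.linear (*s) (*) \<theta>"
  shows "(\<phi>, \<omega>) = heis_cochain p q r s t w \<longleftrightarrow>
    (\<phi>, \<omega>) \<in> carrier (restricted_lie_algebra_char2.C2 (*s)) \<and>
    \<phi> hx hy = p \<and> \<phi> hx hz = q \<and> \<phi> hy hz = r \<and> \<omega> hx = s \<and> \<omega> hy = t \<and> \<omega> hz = w"
    (is "?L \<longleftrightarrow> ?R")
proof -
  interpret restricted_lie_algebra_char2 "(*s)" heis_bracket "heis_sq \<theta>"
    using assms by (rule restricted_lie_algebra_heisenberg)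
  show ?thesis
  proof
    assume ?L
    then have eq:
      "\<phi> = (\<lambda>u v. (u $ 1 * v $ 2 - u $ 2 * v $ 1) *s p + (u $ 1 * v $ 3 - u $ 3 * v $ 1) *s q
         + (u $ 2 * v $ 3 - u $ 3 * v $ 2) *s r)"
      "\<omega> = (\<lambda>u. (u $ 1)^2 *s s + (u $ 2)^2 *s t + (u $ 3)^2 *s w
         + (u $ 1 * u $ 2) *s p + (u $ 1 * u $ 3) *s q + (u $ 2 * u $ 3) *s r)"
      by (simp_all add: heis_cochain_def)
    have "(\<phi>, \<omega>) \<in> carrier C2"
      unfolding mem_C2 eq
      by (auto simp: vec_eq_iff algebra_simps power2_eq_square
          char_2_minus[OF char] char_2_double[OF char] char_2_double'[OF char])
    then show ?R
      by (auto simp: eq vec_eq_iff axis_def)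
  next
    assume R: ?R
    then have *: "\<phi> a (b + c) = \<phi> a b + \<phi> a c" "\<phi> a (k *s b) = k *s \<phi> a b"
      "\<phi> (a + b) c = \<phi> a c + \<phi> b c" "\<phi> (k *s a) b = k *s \<phi> a b" "\<phi> a a = 0"
      "\<omega> (k *s a) = k^2 *s \<omega> a" "\<omega> (a + b) = \<omega> a + \<omega> b + \<phi> a b" for a b c k
      by (simp_all add: mem_C2)
    have comm: "\<phi> a b = \<phi> b a" for a b
    proof -
      have "\<phi> (a + b) (a + b) = 0" by (rule *)
      then have "\<phi> a b + \<phi> b a = 0" by (simp only: *(1,3)) (simp add: *(5) add.commute)
      then show ?thesis by (metis eq_neg_iff_add_eq_0 uminus_eq)
    qed
    have "\<phi> u v = fst (heis_cochain p q r s t w) u v" for u v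
      apply (subst heis_expand[of u], subst heis_expand[of v])
      apply (simp only: *)
      using R comm[of hy hx] comm[of hz hx] comm[of hz hy]
      by (simp add: *(5) heis_cochain_def vec_eq_iff algebra_simps char_2_minus[OF char])
    moreover have "\<omega> u = snd (heis_cochain p q r s t w) u" for u
      apply (subst heis_expand[of u])
      apply (simp only: *)
      using R
      by (simp add: *(5) heis_cochain_def vec_eq_iff algebra_simps)
    ultimately show ?L by (simp add: prod_eq_iff fun_eq_iff)
  qed
qed

end

theory Submission
  imports Defs
begin

text \<open>The 2-map of \<open>\<theta> = \<gamma> z\<^sup>*\<close> treats both algebras at once, with \<open>\<gamma> = 0\<close> and \<open>\<gamma> = 1\<close>. In terms of the
  values \<open>p, q, r, s, t, w\<close> of a cochain on the basis, the cocycle conditions express \<open>q\<close>, \<open>r\<close> and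
  four further coefficients through the remaining ones. A cocycle is then a coboundary iff the coefficient
  of \<open>x\<close> in \<open>\<omega>(x)\<close>, that of \<open>y\<close> in \<open>\<omega>(y)\<close> and, for \<open>\<gamma> = 0\<close>, that of \<open>z\<close> in \<open>\<omega>(z)\<close> vanish; for
  \<open>\<gamma> \<noteq> 0\<close> the last one is killed by the term \<open>\<psi>(z\<^bsup>[2]\<^esup>) = \<gamma> \<psi>(z)\<close> of a coboundary. These
  coefficients are linear functionals dual to the given cocycles, hence coordinates on \<open>H2\<close>.\<close>

section \<open>Bases of quotient spaces\<close>

text \<open>Applying \<open>f i\<close> to a linear combination of the \<open>e j\<close> reads off
  its coefficient at \<open>e i\<close>, which gives independence. A vector \<open>v\<close> and the
  combination with coefficients \<open>f i v\<close> have the same coordinates, so separation makes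
  them equal, which gives spanning.\<close>

lemma (in vectorspace) dual_basis:
  assumes fin: "finite I"
    and e: "\<And>i. i \<in> I \<Longrightarrow> e i \<in> carrier V"
    and f_carrier: "\<And>i v. i \<in> I \<Longrightarrow> v \<in> carrier V \<Longrightarrow> f i v \<in> carrier K"
    and f_add: "\<And>i v w. i \<in> I \<Longrightarrow> v \<in> carrier V \<Longrightarrow> w \<in> carrier V \<Longrightarrow>
      f i (v \<oplus>\<^bsub>V\<^esub> w) = f i v \<oplus>\<^bsub>K\<^esub> f i w"
    and f_smult: "\<And>i a v. i \<in> I \<Longrightarrow> a \<in> carrier K \<Longrightarrow> v \<in> carrier V \<Longrightarrow>
      f i (a \<odot>\<^bsub>V\<^esub> v) = a \<otimes>\<^bsub>K\<^esub> f i v"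
    and dual: "\<And>i j. i \<in> I \<Longrightarrow> j \<in> I \<Longrightarrow> f i (e j) = (if i = j then \<one>\<^bsub>K\<^esub> else \<zero>\<^bsub>K\<^esub>)"
    and separating: "\<And>v w. v \<in> carrier V \<Longrightarrow> w \<in> carrier V \<Longrightarrow>
      (\<And>i. i \<in> I \<Longrightarrow> f i v = f i w) \<Longrightarrow> v = w"
  shows "basis (e ` I)" and "dim = card I"
proof -
  have inj: "inj_on e I"
  proof (rule inj_onI)
    fix i j assume "i \<in> I" "j \<in> I" "e i = e j"
    then show "i = j" using dual[of i i] dual[of i j] by (auto split: if_splits)
  qed
  have sub: "e ` I \<subseteq> carrier V" using e by auto
  have f_zero: "f i \<zero>\<^bsub>V\<^esub> = \<zero>\<^bsub>K\<^esub>" if "i \<in> I" for i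
    using f_smult[OF that, of "\<zero>\<^bsub>K\<^esub>" "\<zero>\<^bsub>V\<^esub>"] f_carrier[OF that, of "\<zero>\<^bsub>V\<^esub>"] by simp
  have coord: "f i (lincomb a (e ` J)) = (if i \<in> J then a (e i) else \<zero>\<^bsub>K\<^esub>)"
    if "i \<in> I" "J \<subseteq> I" "a \<in> e ` I \<rightarrow> carrier K" for i J a
    using finite_subset[OF that(2) fin] that(2)
  proof (induction J rule: finite_induct)
    case empty
    then show ?case using f_zero[OF that(1)] by (simp add: lincomb_def)
  next
    case (insert j J)
    have J: "J \<subseteq> I" "j \<in> I" using insert.prems by auto
    have "e j \<notin> e ` J" using insert.hyps(2) J inj by (auto dest: inj_onD)
    moreover have a: "a \<in> insert (e j) (e ` J) \<rightarrow> carrier K" using that(3) J by auto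
    moreover have eJ: "e ` J \<subseteq> carrier V" using J e by auto
    ultimately have "lincomb a (e ` insert j J) = a (e j) \<odot>\<^bsub>V\<^esub> e j \<oplus>\<^bsub>V\<^esub> lincomb a (e ` J)"
      using insert.hyps(1) e[OF J(2)] by (simp add: lincomb_insert2)
    moreover have "lincomb a (e ` J) \<in> carrier V"
      using a eJ by (intro lincomb_closed) auto
    moreover have "a (e j) \<in> carrier K" using a by auto
    moreover have "a (e i) \<in> carrier K" using that by auto
    ultimately show ?case
      using insert.IH[OF J(1)] insert.hyps(2) e[OF J(2)] that(1) J(2)
      by (auto simp: f_add f_smult dual)
  qed
  have "lin_indpt (e ` I)"
  proof (rule finite_lin_indpt2)
    fix a assume a: "a \<in> e ` I \<rightarrow> carrier K" "lincomb a (e ` I) = \<zero>\<^bsub>V\<^esub>"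
    show "\<forall>v\<in>e ` I. a v = \<zero>\<^bsub>K\<^esub>"
      using coord[OF _ subset_refl a(1)] f_zero a(2) by auto
  qed (use fin sub in auto)
  moreover have "v \<in> span (e ` I)" if v: "v \<in> carrier V" for v
  proof -
    \<comment> \<open>Coefficients are indexed by vectors, so the index is recovered from
      \<open>e i\<close>, which injectivity of \<open>e\<close> permits.\<close>
    define a where "a w = f (inv_into I e w) v" for w
    have ae: "a (e i) = f i v" if "i \<in> I" for i
      using that inj by (simp add: a_def)
    then have a: "a \<in> e ` I \<rightarrow> carrier K" using f_carrier v by auto
    have "lincomb a (e ` I) = v"
      using v coord[OF _ subset_refl a] ae
      by (intro separating lincomb_closed sub a) auto
    then show ?thesis using fin a by (auto simp: span_def)
  qed
  ultimately show "basis (e ` I)"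
    using sub span_is_subset2[OF sub] by (auto simp: basis_def)
  then show "dim = card I"
    using dim_basis[of "e ` I"] fin inj by (simp add: card_image)
qed

text \<open>Since \<open>U\<close> is the joint kernel of the \<open>f i\<close>, these functionals
  descend to the quotient and separate its cosets, so \<open>dual_basis\<close> applies
  there.\<close>

lemma quotient_space_dual_basis:
  fixes V :: "('f, 'v) module" (structure)
  assumes "vectorspace K V" and sub: "VectorSpace.subspace K U V"
    and finite_I: "finite I"
    and e: "\<And>i. i \<in> I \<Longrightarrow> e i \<in> carrier V"
    and f_carrier: "\<And>i v. i \<in> I \<Longrightarrow> v \<in> carrier V \<Longrightarrow> f i v \<in> carrier K"
    and f_add: "\<And>i v w. i \<in> I \<Longrightarrow> v \<in> carrier V \<Longrightarrow> w \<in> carrier V \<Longrightarrow>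
      f i (v \<oplus> w) = f i v \<oplus>\<^bsub>K\<^esub> f i w"
    and f_smult: "\<And>i a v. i \<in> I \<Longrightarrow> a \<in> carrier K \<Longrightarrow> v \<in> carrier V \<Longrightarrow>
      f i (a \<odot> v) = a \<otimes>\<^bsub>K\<^esub> f i v"
    and dual: "\<And>i j. i \<in> I \<Longrightarrow> j \<in> I \<Longrightarrow> f i (e j) = (if i = j then \<one>\<^bsub>K\<^esub> else \<zero>\<^bsub>K\<^esub>)"
    and kernel: "\<And>v. v \<in> carrier V \<Longrightarrow> v \<in> U \<longleftrightarrow> (\<forall>i\<in>I. f i v = \<zero>\<^bsub>K\<^esub>)"
  shows "vectorspace.basis K (quotient_space V U) ((\<lambda>i. U +> e i) ` I)"
    and "vectorspace.dim K (quotient_space V U) = card I"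
proof -
  interpret vectorspace K V by fact
  let ?Q = "quotient_space V U"
  interpret Q: vectorspace K ?Q
    by (rule vectorspace_quotient_space) fact+
  have submod: "LinearCombinations.submodule K U V"
    using sub by (simp add: VectorSpace.subspace_def)
  have UV: "U \<subseteq> carrier V" and U0: "\<zero> \<in> U"
    and Ua: "\<And>v w. v \<in> U \<Longrightarrow> w \<in> U \<Longrightarrow> v \<oplus> w \<in> U"
    and Us: "\<And>c v. c \<in> carrier K \<Longrightarrow> v \<in> U \<Longrightarrow> c \<odot> v \<in> U"
    using submod by (auto simp: LinearCombinations.submodule_def)
  have Un: "\<ominus> v \<in> U" if "v \<in> U" for v
    using Us[of "\<ominus>\<^bsub>K\<^esub> \<one>\<^bsub>K\<^esub>" v] that UV by (auto simp: smult_minus_1)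
  have "additive_subgroup U V"
    unfolding additive_subgroup_def
    by (rule subgroup.intro) (use UV U0 Ua Un in \<open>auto simp: a_inv_def[symmetric]\<close>)
  then interpret A: abelian_subgroup U V
    using abelian_subgroupI3 M.abelian_group_axioms by blast
  have cos: "\<exists>v\<in>carrier V. C = U +> v" if "C \<in> carrier ?Q" for C
    using that by (auto simp: quotient_space_def A_RCOSETS_def')
  have inC: "U +> v \<in> carrier ?Q" if "v \<in> carrier V" for v
    using that by (auto simp: quotient_space_def A_RCOSETS_def')
  have f_coset: "f i c = f i v" if "i \<in> I" "v \<in> carrier V" and c: "c \<in> U +> v" for i v c
  proof -
    obtain u where "u \<in> U" "c = u \<oplus> v" using c by (auto simp: a_r_coset_def')
    then show ?thesis using that UV kernel[of u] by (auto simp: f_add f_carrier)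
  qed
  \<comment> \<open>Any representative serves: by \<open>f_coset\<close>, \<open>f i\<close> is
    constant on each coset.\<close>
  define F where "F i C = f i (SOME c. c \<in> C)" for i C
  have F: "F i (U +> v) = f i v" if "i \<in> I" "v \<in> carrier V" for i v
  proof -
    have "(SOME c. c \<in> U +> v) \<in> U +> v"
      using A.a_rcos_self[OF that(2)] by (rule someI)
    then show ?thesis unfolding F_def using that by (intro f_coset)
  qed
  have plus: "(U +> v) \<oplus>\<^bsub>?Q\<^esub> (U +> w) = U +> (v \<oplus> w)"
    if "v \<in> carrier V" "w \<in> carrier V" for v w
    using that by (simp add: quotient_space_def A.a_rcos_sum)
  have coset_eq: "U +> v = U +> w"
    if "v \<in> carrier V" "w \<in> carrier V" "\<And>i. i \<in> I \<Longrightarrow> f i v = f i w" for v w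
  proof -
    have "f i (v \<ominus> w) = \<zero>\<^bsub>K\<^esub>" if "i \<in> I" for i
    proof -
      have "f i (v \<ominus> w) \<oplus>\<^bsub>K\<^esub> f i w = f i (v \<ominus> w \<oplus> w)"
        using that \<open>v \<in> carrier V\<close> \<open>w \<in> carrier V\<close> by (simp add: f_add)
      also have "\<dots> = f i w"
        using that \<open>v \<in> carrier V\<close> \<open>w \<in> carrier V\<close> \<open>\<And>i. i \<in> I \<Longrightarrow> f i v = f i w\<close>
        by (simp add: M.minus_eq M.a_assoc M.l_neg)
      finally show ?thesis
        using that \<open>v \<in> carrier V\<close> \<open>w \<in> carrier V\<close>
        by (metis M.minus_closed R.add.r_cancel_one f_carrier)
    qed
    then have "v \<ominus> w \<in> U" using kernel that by simp
    then have "v \<in> U +> w"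
      using that by (auto simp: a_r_coset_def' M.minus_eq M.a_assoc M.l_neg intro!: bexI[of _ "v \<ominus> w"])
    then show ?thesis using A.a_repr_independence' that by blast
  qed
  have scal: "a \<odot>\<^bsub>?Q\<^esub> (U +> v) = U +> (a \<odot> v)"
    if "v \<in> carrier V" "a \<in> carrier K" for v a
  proof -
    \<comment> \<open>Scaling in the quotient is a union over all representatives; it collapses
      because equal coordinates force equal cosets.\<close>
    have "U +> (a \<odot> c) = U +> (a \<odot> v)" if c: "c \<in> U +> v" for c
    proof (rule coset_eq)
      show "a \<odot> c \<in> carrier V"
        using c A.a_elemrcos_carrier \<open>v \<in> carrier V\<close> \<open>a \<in> carrier K\<close> by blast
      show "f i (a \<odot> c) = f i (a \<odot> v)" if "i \<in> I" for i
        using that c f_coset A.a_elemrcos_carrier \<open>v \<in> carrier V\<close> \<open>a \<in> carrier K\<close>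
        by (metis f_smult)
    qed (use \<open>v \<in> carrier V\<close> \<open>a \<in> carrier K\<close> in auto)
    then have "(\<Union>c\<in>U +> v. U +> (a \<odot> c)) = (\<Union>c\<in>U +> v. U +> (a \<odot> v))"
      by (rule SUP_cong[OF refl])
    also have "\<dots> = U +> (a \<odot> v)"
      using A.a_rcos_self[OF that(1)] by blast
    finally show ?thesis by (simp add: quotient_space_def)
  qed
  have F_carrier: "F i C \<in> carrier K"
    if "i \<in> I" "C \<in> carrier ?Q" for i C
    using cos[OF that(2)] that(1) by (auto simp: F f_carrier)
  have F_smult: "F i (a \<odot>\<^bsub>?Q\<^esub> C) = a \<otimes>\<^bsub>K\<^esub> F i C"
    if "i \<in> I" "a \<in> carrier K" "C \<in> carrier ?Q" for i a C
    using cos[OF that(3)] that(1,2) by (auto simp: F f_smult scal)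
  have F_add: "F i (C \<oplus>\<^bsub>?Q\<^esub> D) = F i C \<oplus>\<^bsub>K\<^esub> F i D"
    if "i \<in> I" "C \<in> carrier ?Q" "D \<in> carrier ?Q" for i C D
    using cos[OF that(2)] cos[OF that(3)] that(1) by (auto simp: F f_add plus)
  have F_separating: "C = D"
    if "C \<in> carrier ?Q" "D \<in> carrier ?Q" "\<And>i. i \<in> I \<Longrightarrow> F i C = F i D" for C D
    using that cos coset_eq F by metis
  show "Q.basis ((\<lambda>i. U +> e i) ` I)" "Q.dim = card I"
    by (rule Q.dual_basis[where f = F and e = "\<lambda>i. U +> e i",
          OF finite_I _ F_carrier F_add F_smult _ F_separating]; simp add: F e dual inC)+
qed


section \<open>Cocycles and coboundaries of the Heisenberg algebra\<close>

context
  fixes \<gamma> :: "'f::Fields.field"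
  assumes char: "CHAR('f) = 2"
begin

interpretation restricted_lie_algebra_char2 "(*s)" heis_bracket "heis_sq (\<lambda>v. \<gamma> * v $ 3)"
proof (rule restricted_lie_algebra_heisenberg[OF char])
  show "Vector_Spaces.linear (*s) (*) (\<lambda>v. \<gamma> * v $ 3)"
    by unfold_locales (auto simp: algebra_simps)
qed

section \<open>Cochains in coordinates\<close>

lemmas char_2_simps = char_2_minus[OF char] char_2_double[OF char] char_2_double'[OF char]

lemma heis_cochain_mem_C2: "heis_cochain p q r s t w \<in> carrier C2"
  unfolding heis_cochain_def mem_C2
  by (auto simp: vec_eq_iff algebra_simps power2_eq_square char_2_simps)

lemma mem_C2_heis_cochain:
  assumes "c \<in> carrier C2"
  obtains p q r s t w where "c = heis_cochain p q r s t w"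
proof -
  obtain \<phi> \<omega> where "c = (\<phi>, \<omega>)" by (metis surj_pair)
  moreover have "Vector_Spaces.linear (*s) (*) (\<lambda>v. \<gamma> * v $ 3)"
    by unfold_locales (auto simp: algebra_simps)
  ultimately show ?thesis
    using that heis_cochain_unique[OF char, of "\<lambda>v. \<gamma> * v $ 3"] assms by metis
qed

text \<open>Differences are rewritten as sums, so that every identity below becomes, in each
  coordinate, a polynomial identity whose terms cancel in pairs.\<close>

lemma heis_components:
  "heis_bracket u v $ 1 = 0" "heis_bracket u v $ 2 = 0"
  "heis_bracket u v $ 3 = u $ 1 * v $ 2 + u $ 2 * v $ 1"
  "heis_sq (\<lambda>v. \<gamma> * v $ 3) v $ 1 = 0" "heis_sq (\<lambda>v. \<gamma> * v $ 3) v $ 2 = 0"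
  "heis_sq (\<lambda>v. \<gamma> * v $ 3) v $ 3 = \<gamma> * (v $ 3)^2 + v $ 1 * v $ 2"
  "fst (heis_cochain p q r s t w) u v $ i = (u $ 1 * v $ 2 + u $ 2 * v $ 1) * p $ i
    + (u $ 1 * v $ 3 + u $ 3 * v $ 1) * q $ i + (u $ 2 * v $ 3 + u $ 3 * v $ 2) * r $ i"
  "snd (heis_cochain p q r s t w) u $ i = (u $ 1)^2 * s $ i + (u $ 2)^2 * t $ i + (u $ 3)^2 * w $ i
    + u $ 1 * u $ 2 * p $ i + u $ 1 * u $ 3 * q $ i + u $ 2 * u $ 3 * r $ i"
  "hx $ 1 = (1 :: 'f)" "hx $ 2 = (0 :: 'f)" "hx $ 3 = (0 :: 'f)"
  "hy $ 1 = (0 :: 'f)" "hy $ 2 = (1 :: 'f)" "hy $ 3 = (0 :: 'f)"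
  "hz $ 1 = (0 :: 'f)" "hz $ 2 = (0 :: 'f)" "hz $ 3 = (1 :: 'f)"
  by (simp_all add: heis_bracket_def heis_sq_def heis_cochain_def axis_def char_2_minus[OF char])

text \<open>The projections \<open>fst\<close> and \<open>snd\<close> allow
  \<open>heis_cochain\<close> to stay folded, which is the form that \<open>heis_components\<close>
  rewrites; \<open>mem_B2\<close> has the same purpose.\<close>

lemma mem_Z2:
  "c \<in> Z2 \<longleftrightarrow> c \<in> carrier C2 \<and>
    (\<forall>u v w. fst c (heis_bracket u v) w + fst c (heis_bracket u w) v + fst c (heis_bracket v w) u
      + heis_bracket u (fst c v w) + heis_bracket v (fst c u w) + heis_bracket w (fst c u v) = 0) \<and>
    (\<forall>u v. fst c u (heis_sq (\<lambda>v. \<gamma> * v $ 3) v) + heis_bracket u (snd c v)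
      + heis_bracket (fst c u v) v + fst c (heis_bracket u v) v = 0)"
  by (cases c) (simp add: Z2_def)

lemma mem_B2:
  "c \<in> B2 \<longleftrightarrow> (\<exists>\<psi>. Vector_Spaces.linear (*s) (*s) \<psi> \<and>
    (\<forall>u v. fst c u v = \<psi> (heis_bracket u v) + heis_bracket u (\<psi> v) + heis_bracket v (\<psi> u)) \<and>
    (\<forall>u. snd c u = \<psi> (heis_sq (\<lambda>v. \<gamma> * v $ 3) u) + heis_bracket u (\<psi> u)))"
  by (cases c) (simp add: B2_def)

section \<open>Cocycle and coboundary conditions in coordinates\<close>

lemma two_eq_0: "(2 :: 'f) = 0"
  using char_2_double[OF char, of 1] by simp

lemma add_eq_0_iff_eq: "a + b = 0 \<longleftrightarrow> a = (b :: 'f)"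
  using char_2_minus[OF char, of a b] by (metis eq_iff_diff_eq_0)

lemma heis_cochain_mem_Z2:
  "heis_cochain p q r s t w \<in> Z2 \<longleftrightarrow>
    q = (s $ 1 + p $ 2) *s hz \<and> r = (t $ 2 + p $ 1) *s hz \<and> s $ 2 = 0 \<and> t $ 1 = 0 \<and>
    w $ 1 = \<gamma> * (t $ 2 + p $ 1) \<and> w $ 2 = \<gamma> * (s $ 1 + p $ 2)" (is "?L \<longleftrightarrow> ?R")
proof
  assume L: ?L
  let ?\<phi> = "fst (heis_cochain p q r s t w)" and ?\<omega> = "snd (heis_cochain p q r s t w)"
  \<comment> \<open>The cocycle identity for the 2-map, evaluated at pairs of basis vectors, yields
    all the conditions. For instance, \<open>u = y\<close>, \<open>v = x\<close> gives
    \<open>q $ 1 = 0\<close> in coordinate 1 and \<open>q $ 3 = s $ 1 + p $ 2\<close> in coordinate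
    3.\<close>
  have *: "(?\<phi> u (heis_sq (\<lambda>v. \<gamma> * v $ 3) v) + heis_bracket u (?\<omega> v) + heis_bracket (?\<phi> u v) v
      + ?\<phi> (heis_bracket u v) v) $ i = 0" for u v i
    using L unfolding mem_Z2 by simp
  note ** = *[unfolded vector_add_component]
  have "q $ 1 = 0" "q $ 2 = 0" "q $ 3 = s $ 1 + p $ 2" "s $ 2 = 0"
    using **[of hy hx 1] **[of hz hx 3] **[of hy hx 3] **[of hx hx 3]
    by (simp_all add: heis_components add_eq_0_iff_eq add_ac two_eq_0)
  moreover have "r $ 1 = 0" "r $ 2 = 0" "r $ 3 = t $ 2 + p $ 1" "t $ 1 = 0"
    using **[of hz hy 3] **[of hx hy 2] **[of hx hy 3] **[of hy hy 3]
    by (simp_all add: heis_components add_eq_0_iff_eq add_ac two_eq_0)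
  moreover have "w $ 2 = \<gamma> * q $ 3" "w $ 1 = \<gamma> * r $ 3"
    using **[of hx hz 3] **[of hy hz 3] \<open>q $ 1 = 0\<close> \<open>q $ 2 = 0\<close> \<open>r $ 1 = 0\<close> \<open>r $ 2 = 0\<close>
    by (simp_all add: heis_components add_eq_0_iff_eq)
  ultimately show ?R
    by (simp add: vec_eq_iff forall_3 heis_components)
next
  assume ?R
  then have R: "q $ 1 = 0" "q $ 2 = 0" "q $ 3 = s $ 1 + p $ 2"
    "r $ 1 = 0" "r $ 2 = 0" "r $ 3 = t $ 2 + p $ 1"
    "s $ 2 = 0" "t $ 1 = 0" "w $ 1 = \<gamma> * (t $ 2 + p $ 1)" "w $ 2 = \<gamma> * (s $ 1 + p $ 2)"
    by (simp_all add: heis_components)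
  show ?L
    unfolding mem_Z2 vec_eq_iff forall_3 vector_add_component heis_components R zero_index
    by (auto simp: heis_cochain_mem_C2 distrib_left distrib_right ac_simps power2_eq_square
        char_2_double[OF char] char_2_double'[OF char])
qed

text \<open>The vector \<open>d\<close> is the image of \<open>z\<close> under
  \<open>\<psi>\<close>. Brackets only affect the \<open>z\<close>-coordinate, so
  \<open>\<phi>(x,y)\<close> agrees with \<open>d\<close> in the other two coordinates,
  \<open>\<omega>(x)\<close> and \<open>\<omega>(y)\<close> are multiples of \<open>z\<close>, and
  \<open>\<omega>(z) = \<gamma> d\<close>.\<close>

lemma heis_cochain_mem_B2:
  "heis_cochain p q r s t w \<in> B2 \<longleftrightarrow>
    q = p $ 2 *s hz \<and> r = p $ 1 *s hz \<and> s = s $ 3 *s hz \<and> t = t $ 3 *s hz \<and>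
    (\<exists>d. d $ 1 = p $ 1 \<and> d $ 2 = p $ 2 \<and> w = \<gamma> *s d)" (is "?L \<longleftrightarrow> ?R")
proof
  assume ?L
  then obtain \<psi> where \<psi>: "Vector_Spaces.linear (*s) (*s) \<psi>"
    and \<phi>: "\<And>u v. fst (heis_cochain p q r s t w) u v
      = \<psi> (heis_bracket u v) + heis_bracket u (\<psi> v) + heis_bracket v (\<psi> u)"
    and \<omega>: "\<And>u. snd (heis_cochain p q r s t w) u
      = \<psi> (heis_sq (\<lambda>v. \<gamma> * v $ 3) u) + heis_bracket u (\<psi> u)"
    unfolding mem_B2 by blast
  \<comment> \<open>Brackets and values of the 2-map are multiples of \<open>z\<close>, so
    \<open>\<psi>\<close> acts on them through \<open>\<psi> hz\<close> alone.\<close>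
  have \<psi>_hz: "\<psi> u = u $ 3 *s \<psi> hz" if "u $ 1 = 0" "u $ 2 = 0" for u
    using linear_add_simps(2)[OF \<psi>, of "u $ 3" hz] heis_expand[of u] that by simp
  have \<psi>_bracket: "\<psi> (heis_bracket u v) = heis_bracket u v $ 3 *s \<psi> hz"
    and \<psi>_sq: "\<psi> (heis_sq (\<lambda>v. \<gamma> * v $ 3) u) = heis_sq (\<lambda>v. \<gamma> * v $ 3) u $ 3 *s \<psi> hz" for u v
    by (rule \<psi>_hz; simp add: heis_components)+
  note eqs = \<phi>[unfolded \<psi>_bracket vec_eq_iff] \<omega>[unfolded \<psi>_sq vec_eq_iff]
  have "\<psi> hz $ 1 = p $ 1 \<and> \<psi> hz $ 2 = p $ 2 \<and> w = \<gamma> *s \<psi> hz"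
    using eqs(1)[of hx hy] eqs(2)[of hz] by (simp add: vec_eq_iff forall_3 heis_components)
  moreover have "q = p $ 2 *s hz" "r = p $ 1 *s hz"
    using eqs(1)[of hx hz] eqs(1)[of hy hz] calculation
    by (simp_all add: vec_eq_iff forall_3 heis_components)
  moreover have "s = s $ 3 *s hz" "t = t $ 3 *s hz"
    using eqs(2)[of hx] eqs(2)[of hy] by (simp_all add: vec_eq_iff forall_3 heis_components)
  ultimately show ?R by blast
next
  assume R: ?R
  then obtain d where "d $ 1 = p $ 1" "d $ 2 = p $ 2" "w = \<gamma> *s d" by blast
  with R have R: "q $ 1 = 0" "q $ 2 = 0" "q $ 3 = p $ 2" "r $ 1 = 0" "r $ 2 = 0" "r $ 3 = p $ 1"
    "s $ 1 = 0" "s $ 2 = 0" "t $ 1 = 0" "t $ 2 = 0"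
    "w $ 1 = \<gamma> * p $ 1" "w $ 2 = \<gamma> * p $ 2" "w $ 3 = \<gamma> * d $ 3" "d $ 1 = p $ 1" "d $ 2 = p $ 2"
    by (auto simp: vec_eq_iff forall_3 heis_components)
  \<comment> \<open>Since \<open>[x, \<psi>(x)]\<close> sees only the \<open>y\<close>-coordinate of
    \<open>\<psi>(x)\<close>, that coordinate must be \<open>s $ 3\<close>; likewise
    \<open>t $ 3\<close> for \<open>y\<close>. The \<open>x\<close>-coordinate of
    \<open>\<psi>(x)\<close> then corrects the \<open>z\<close>-coordinate of
    \<open>\<phi>(x,y)\<close> from \<open>d $ 3\<close> to \<open>p $ 3\<close>.\<close>
  define \<psi> where "\<psi> u = u $ 1 *s ((p $ 3 + d $ 3) *s hx + s $ 3 *s hy)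
    + u $ 2 *s (t $ 3 *s hx) + u $ 3 *s d" for u :: "'f ^ 3"
  have \<psi>_components: "\<psi> u $ 1 = u $ 1 * (p $ 3 + d $ 3) + u $ 2 * t $ 3 + u $ 3 * p $ 1"
    "\<psi> u $ 2 = u $ 1 * s $ 3 + u $ 3 * p $ 2" "\<psi> u $ 3 = u $ 3 * d $ 3" for u
    by (simp_all add: \<psi>_def heis_components R)
  have "Vector_Spaces.linear (*s) (*s) \<psi>"
    by unfold_locales (auto simp: \<psi>_def algebra_simps)
  then show ?L
    unfolding mem_B2
    by (intro exI[of _ \<psi>])
      (auto simp: vec_eq_iff forall_3 heis_components R \<psi>_components distrib_left distrib_right
        ac_simps power2_eq_square char_2_double[OF char] char_2_double'[OF char])
qed

text \<open>In the index type \<open>3\<close> the numeral \<open>3\<close> is \<open>0\<close>, so \<open>1\<close>, \<open>2\<close>, \<open>3\<close> are its three elements.\<close>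

lemma mem_B2_iff_coordinates:
  assumes "c \<in> Z2"
  shows "c \<in> B2 \<longleftrightarrow> (\<forall>i\<in>{i. i = 3 \<longrightarrow> \<gamma> = 0}. snd c (axis i 1) $ i = 0)"
proof -
  have "c \<in> carrier C2" using assms by (simp add: mem_Z2)
  then obtain p q r s t w where c: "c = heis_cochain p q r s t w"
    by (rule mem_C2_heis_cochain)
  have Z: "q = (s $ 1 + p $ 2) *s hz" "r = (t $ 2 + p $ 1) *s hz" "s $ 2 = 0" "t $ 1 = 0"
    "w $ 1 = \<gamma> * (t $ 2 + p $ 1)" "w $ 2 = \<gamma> * (s $ 1 + p $ 2)"
    using assms unfolding c heis_cochain_mem_Z2 by auto
  have "c \<in> B2 \<longleftrightarrow> s $ 1 = 0 \<and> t $ 2 = 0 \<and> (\<gamma> = 0 \<longrightarrow> w $ 3 = 0)"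
  proof
    assume "c \<in> B2"
    then show "s $ 1 = 0 \<and> t $ 2 = 0 \<and> (\<gamma> = 0 \<longrightarrow> w $ 3 = 0)"
      unfolding c heis_cochain_mem_B2 by (auto simp: vec_eq_iff forall_3 heis_components)
  next
    assume *: "s $ 1 = 0 \<and> t $ 2 = 0 \<and> (\<gamma> = 0 \<longrightarrow> w $ 3 = 0)"
    \<comment> \<open>If \<open>\<gamma> = 0\<close>, the cocycle conditions and the hypothesis give
      \<open>w = 0\<close>, so \<open>d = p\<close> will do. Otherwise \<open>w = \<gamma> d\<close>
      forces \<open>d\<close>, and the cocycle conditions make its first two coordinates those of
      \<open>p\<close>.\<close>
    define d where "d = (if \<gamma> = 0 then p else inverse \<gamma> *s w)"
    have "d $ 1 = p $ 1 \<and> d $ 2 = p $ 2 \<and> w = \<gamma> *s d"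
      using * Z(5,6) by (simp add: d_def vec_eq_iff forall_3)
    then show "c \<in> B2"
      unfolding c heis_cochain_mem_B2 using Z(1-4) *
      by (auto simp: vec_eq_iff forall_3 heis_components)
  qed
  also have "\<dots> \<longleftrightarrow> (\<forall>i\<in>{i. i = 3 \<longrightarrow> \<gamma> = 0}. snd c (axis i 1) $ i = 0)"
    by (auto simp: c Ball_def forall_3 heis_components)
  finally show ?thesis .
qed

text \<open>The diagonal coefficients of \<open>\<omega>\<close> indexed by \<open>J\<close> are
  linear on cocycles and have joint kernel \<open>B2\<close> there, so any cocycles dual to them
  represent a basis. The index 3 belongs to \<open>J\<close> only for \<open>\<gamma> = 0\<close>,
  which accounts for the two dimensions.\<close>

lemma H2_dual_basis:
  defines "J \<equiv> {i. i = 3 \<longrightarrow> \<gamma> = 0}"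
  assumes e: "\<And>i. i \<in> J \<Longrightarrow> e i \<in> Z2"
    and dual: "\<And>i j. i \<in> J \<Longrightarrow> j \<in> J \<Longrightarrow> snd (e j) (axis i 1) $ i = (if i = j then 1 else 0)"
  shows "vectorspace.basis class_ring H2 ((\<lambda>i. coh_class (e i)) ` J)"
    and "vectorspace.dim class_ring H2 = card J"
proof -
  have vs: "vectorspace class_ring (C2\<lparr>carrier := Z2\<rparr>)"
    using subspace_B2 by (simp add: VectorSpace.subspace_def)
  show "vectorspace.basis class_ring H2 ((\<lambda>i. coh_class (e i)) ` J)"
    and "vectorspace.dim class_ring H2 = card J"
    unfolding H2_def coh_class_def
    by (rule quotient_space_dual_basis[OF vs subspace_B2,
          where e = e and f = "\<lambda>i c. snd c (axis i 1) $ i"];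
        auto simp: e dual mem_B2_iff_coordinates C2_def J_def[symmetric] split: prod.splits)+
qed

end

section \<open>Explicit bases for the two forms\<close>

theorem theorem5p14:
  assumes "CHAR('f::alg_closed_field) = 2"
  shows "vectorspace.dim class_ring (heis_H2 (\<lambda>_ :: 'f ^ 3. 0 :: 'f)) = 3
    \<and> vectorspace.dim class_ring (heis_H2 (zstar :: 'f ^ 3 \<Rightarrow> 'f)) = 2
    \<and> vectorspace.basis class_ring (heis_H2 (\<lambda>_ :: 'f ^ 3. 0 :: 'f))
        {heis_class (\<lambda>_. 0) (heis_cochain 0 0 hz 0 hy 0),
         heis_class (\<lambda>_. 0) (heis_cochain 0 hz 0 hx 0 0),
         heis_class (\<lambda>_. 0) (heis_cochain 0 0 0 0 0 hz)}
    \<and> vectorspace.basis class_ring (heis_H2 (zstar :: 'f ^ 3 \<Rightarrow> 'f))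
        {heis_class zstar (heis_cochain hx 0 0 0 hy 0),
         heis_class zstar (heis_cochain hy 0 0 hx 0 0)}"
proof -
  note [simp] = heis_cochain_mem_Z2[OF assms] heis_components[OF assms] two_eq_0[OF assms]
  have J0: "{i :: 3. i = 3 \<longrightarrow> (0 :: 'f) = 0} = {1, 2, 3}"
    and J1: "{i :: 3. i = 3 \<longrightarrow> (1 :: 'f) = 0} = {1, 2}"
    using exhaust_3 by auto
  \<comment> \<open>The cocycle at index \<open>i\<close> has diagonal coefficient 1 at the
    \<open>i\<close>-th basis vector. This lists the one with \<open>\<omega>(x) = x\<close> before
    the one with \<open>\<omega>(y) = y\<close>, opposite to the statement;
    \<open>insert_commute\<close> reconciles the two orders.\<close>
  let ?e0 = "\<lambda>i :: 3. if i = 1 then heis_cochain 0 hz 0 hx 0 0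
    else if i = 2 then heis_cochain 0 0 hz 0 hy 0
    else heis_cochain 0 0 0 0 0 hz :: ('f ^ 3) cochain2"
  let ?e1 = "\<lambda>i :: 3. if i = 1 then heis_cochain hy 0 0 hx 0 0
    else heis_cochain hx 0 0 0 hy 0 :: ('f ^ 3) cochain2"
  have Z0: "?e0 i \<in> restricted_lie_algebra_char2.Z2 (*s) heis_bracket (heis_sq (\<lambda>v. 0 * v $ 3))"
    and Z1: "?e1 i \<in> restricted_lie_algebra_char2.Z2 (*s) heis_bracket (heis_sq (\<lambda>v. 1 * v $ 3))"
    for i
    unfolding if_distrib[of "\<lambda>c. c \<in> _"] heis_cochain_mem_Z2[OF assms] by auto
  have dual0: "snd (?e0 j) (axis i 1) $ i = (if i = j then 1 else 0)" for i j
    using exhaust_3[of i] exhaust_3[of j] by auto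
  have dual1: "snd (?e1 j) (axis i 1) $ i = (if i = j then 1 else 0)"
    if "i \<in> {1, 2}" "j \<in> {1, 2}" for i j
    using that by auto
  show ?thesis
    using H2_dual_basis[OF assms, where \<gamma> = 0 and e = ?e0, unfolded J0, OF Z0 dual0]
      H2_dual_basis[OF assms, where \<gamma> = 1 and e = ?e1, unfolded J1, OF Z1 dual1]
    by (simp add: insert_commute)
qed

end
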